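(* Let $P$ be a program and $\mu \in \mathrm{Meas}(\mathbb{N}^n_\dagger)$. Then for all $S \subseteq \mathbb{N}^n_\dagger$, the unnormalized probabilities can be bounded: $$[\![P]\!]_{\mathsf{lo}}(\mu)(S) \;\le\; [\![P]\!]_\dagger(\mu)(S) \;\le\; [\![P]\!]_{\mathsf{lo}}(\mu)(S) + [\![P]\!]_{\mathsf{res}}(\mu).$$ If $\mu$ is a probability measure and $S \subseteq \mathbb{N}^n$, the posterior probabilities can be bounded: $$\frac{[\![P]\!]_{\mathsf{lo}}(\mu)(S)}{1 - [\![P]\!]_{\mathsf{lo}}(\mu)(\dagger)} \;\le\; \mathrm{normalize}([\![P]\!]_\dagger(\mu))(S) \;\le\; \frac{[\![P]\!]_{\mathsf{lo}}(\mu)(S) + [\![P]\!]_{\mathsf{res}}(\mu)}{1 - [\![P]\!]_{\mathsf{lo}}(\mu)(\dagger) - [\![P]\!]_{\mathsf{res}}(\mu)}.$$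
   Context: Language. Fix $n$ variables $X_1,\dots,X_n$ with values in $\mathbb{N}=\{0,1,2,\dots\}$. Programs $P$ and events $E$ are given by $P ::= \mathsf{skip} \mid P_1;P_2 \mid X_k := 0 \mid X_k \mathrel{+}= a \mid X_k \mathrel{\dot-}= 1 \mid \mathsf{if}\ E\ \{P_1\}\ \mathsf{else}\ \{P_2\} \mid \mathsf{while}\ E\ \{P_1\} \mid \mathsf{fail}$ and $E ::= X_k = a \mid \mathsf{flip}(\rho) \mid \lnot E_1 \mid E_1 \land E_2$, with literals $a \in \mathbb{N}$, $\rho \in [0,1]$. State space. $\mathbb{N}^n_\dagger := \mathbb{N}^n \cup \{\dagger\}$ where $\dagger$ is a failure state; all $\sigma$-algebras are discrete, and $\mathrm{Meas}(M)$ is the set of measures on $M$. For a point $x$, $\mu(x)$ abbreviates $\mu(\{x\})$. For measures, $\mu \preceq \nu$ means $\mu(S)\le\nu(S)$ for all $S$; for measure transformers, $\phi \sqsubseteq \psi$ means $\phi(\mu)\preceq\psi(\mu)$ for all $\mu$. Write $\mu|_\dagger$ and $\mu|_{\mathbb{N}^n}$ for the restrictions of $\mu$ to $\{\dagger\}$ and $\mathbb{N}^n$; $\boldsymbol{x}[k\mapsto v]$ is $\boldsymbol{x}$ with $k$-th entry replaced by $v$; $x \mathbin{\dot-} 1 := \max(x-1,0)$. $\mathrm{Dirac}(\dagger)$ is the point mass at $\dagger$. Event semantics. $\mu|_{X_k=a}(S) := \mu(\{\boldsymbol{x}\in S\cap\mathbb{N}^n : x_k=a\})$, $\mu|_{\mathsf{flip}(\rho)}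 := \rho\cdot\mu|_{\mathbb{N}^n}$, $\mu|_{\lnot E_1} := \mu|_{\mathbb{N}^n}-\mu|_{E_1}$, $\mu|_{E_1\land E_2} := (\mu|_{E_1})|_{E_2}$. Standard semantics $[\![P]\!]_\dagger : \mathrm{Meas}(\mathbb{N}^n_\dagger)\to\mathrm{Meas}(\mathbb{N}^n_\dagger)$: $[\![\mathsf{skip}]\!]_\dagger(\mu)=\mu$; $[\![P_1;P_2]\!]_\dagger(\mu)=[\![P_2]\!]_\dagger([\![P_1]\!]_\dagger(\mu))$; $[\![X_k:=0]\!]_\dagger(\mu)(S)=\mu|_\dagger(S)+\mu(\{\boldsymbol{x}\in\mathbb{N}^n : \boldsymbol{x}[k\mapsto 0]\in S\})$; $[\![X_k \mathrel{+}= a]\!]_\dagger(\mu)(S)=\mu|_\dagger(S)+\mu(\{\boldsymbol{x}\in\mathbb{N}^n : \boldsymbol{x}[k\mapsto x_k+a]\in S\})$; $[\![X_k \mathrel{\dot-}= 1]\!]_\dagger(\mu)(S)=\mu|_\dagger(S)+\mu(\{\boldsymbol{x}\in\mathbb{N}^n : \boldsymbol{x}[k\mapsto x_k\mathbin{\dot-}1]\in S\})$; $[\![\mathsf{if}\ E\ \{P_1\}\ \mathsf{else}\ \{P_2\}]\!]_\dagger(\mu)=\mu|_\dagger+[\![P_1]\!]_\dagger(\mu|_E)+[\![P_2]\!]_\dagger(\mu|_{\lnot E})$; $[\![\mathsf{fail}]\!]_\dagger(\mu)=\mu(\mathbb{N}^n_\dagger)\cdot\mathrm{Dirac}(\dagger)$;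 $[\![\mathsf{while}\ E\ \{P_1\}]\!]_\dagger$ is the least fixed point (w.r.t. $\sqsubseteq$) of $\Phi_{E,P_1}(\psi)(\mu) := \mu|_\dagger+\mu|_{\lnot E}+\psi([\![P_1]\!]_\dagger(\mu|_E))$. Lower bound semantics. $[\![P]\!]_{\mathsf{lo}}$ is defined by the same recursive clauses as $[\![P]\!]_\dagger$ except that $[\![\mathsf{while}\ E\ \{P_1\}]\!]_{\mathsf{lo}}(\mu) := 0$ (the zero measure). Residual mass. $[\![P]\!]_{\mathsf{res}}(\mu) := \mu(\mathbb{N}^n_\dagger)-[\![P]\!]_{\mathsf{lo}}(\mu)(\mathbb{N}^n_\dagger)\in\mathbb{R}_{\ge0}$. Normalization. $\mathrm{normalize}$ turns subprobability measures on $\mathbb{N}^n_\dagger$ into subprobability measures on $\mathbb{N}^n$: $\mathrm{normalize}(\nu) := \dfrac{\nu-\nu|_\dagger}{1-\nu(\dagger)}$. *)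

theory Defs
  imports "HOL-Probability.Probability"
begin

section \<open>Syntax\<close>

typedef prob = "{0..1 :: real}"
  morphisms real_of_prob Prob
  by (rule exI[of _ 0]) simp

text \<open>The variables are indexed by a finite type \<open>'n\<close>, so \<open>n = CARD('n)\<close>.\<close>

datatype 'n event =
    VarEq 'n nat
  | Flip prob
  | Not "'n event"
  | And "'n event" "'n event"

datatype 'n prog =
    Skip
  | Seq "'n prog" "'n prog"
  | SetZero 'n
  | Incr 'n nat
  | Decr 'n
  | Cond "'n event" "'n prog" "'n prog"
  | While "'n event" "'n prog"
  | Fail


section \<open>Measures on discrete spaces\<close>

text \<open>
  The failure state is \<open>None\<close> and a valuation \<open>x\<close> is \<open>Some x\<close>; thus \<open>range Some\<close>
  is the copy of the proper state space inside the space with failure.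
\<close>

type_synonym 'n state = "('n \<Rightarrow> nat) option"

definition Meas :: "'a measure set" where
  "Meas = {\<mu>. sets \<mu> = UNIV}"

definition measure_leq :: "'a measure \<Rightarrow> 'a measure \<Rightarrow> bool" (infix "\<preceq>" 50) where
  "\<mu> \<preceq> \<nu> \<longleftrightarrow> (\<forall>S. emeasure \<mu> S \<le> emeasure \<nu> S)"

definition transformer_leq ::
    "('a measure \<Rightarrow> 'a measure) \<Rightarrow> ('a measure \<Rightarrow> 'a measure) \<Rightarrow> bool" (infix "\<sqsubseteq>" 50) where
  "\<phi> \<sqsubseteq> \<psi> \<longleftrightarrow> (\<forall>\<mu>\<in>Meas. \<phi> \<mu> \<preceq> \<psi> \<mu>)"

text \<open>
  \<open>measure_of\<close> yields the zero measure if the given set function is not a measure; for each use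
  of \<open>discrete_measure\<close> below, a lemma shows that this does not happen.
\<close>

definition discrete_measure :: "('a set \<Rightarrow> ennreal) \<Rightarrow> 'a measure" where
  "discrete_measure f = measure_of UNIV UNIV f"

definition restrict_meas :: "'a measure \<Rightarrow> 'a set \<Rightarrow> 'a measure" where
  "restrict_meas \<mu> A = discrete_measure (\<lambda>S. emeasure \<mu> (S \<inter> A))"

definition add_meas :: "'a measure \<Rightarrow> 'a measure \<Rightarrow> 'a measure" (infixl "+\<^sub>m" 65) where
  "\<mu> +\<^sub>m \<nu> = discrete_measure (\<lambda>S. emeasure \<mu> S + emeasure \<nu> S)"

text \<open>
  The difference is taken on point masses. It agrees with the difference taken on sets whenever
  the subtracted measure is finite and below the other one (lemma \<open>emeasure_diff_meas\<close>; for the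
  use in negated events see \<open>restrict_event_le\<close>). Unlike the latter it is a measure also when the
  difference on some sets would be \<open>\<infinity> - \<infinity>\<close>.
\<close>

definition diff_meas :: "'a measure \<Rightarrow> 'a measure \<Rightarrow> 'a measure" (infixl "-\<^sub>m" 65) where
  "\<mu> -\<^sub>m \<nu> = density (count_space UNIV) (\<lambda>x. emeasure \<mu> {x} - emeasure \<nu> {x})"

abbreviation zero_meas :: "'a measure" where
  "zero_meas \<equiv> null_measure (count_space UNIV)"

abbreviation restrict_failure :: "'n state measure \<Rightarrow> 'n state measure" where
  "restrict_failure \<mu> \<equiv> restrict_meas \<mu> {None}"

abbreviation restrict_proper :: "'n state measure \<Rightarrow> 'n state measure" where
  "restrict_proper \<mu> \<equiv> restrict_meas \<mu> (range Some)"


section \<open>Semantics\<close>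

primrec restrict_event :: "'n event \<Rightarrow> 'n state measure \<Rightarrow> 'n state measure" where
  "restrict_event (VarEq k a) \<mu> = restrict_meas \<mu> {Some x | x. x k = a}"
| "restrict_event (Flip \<rho>) \<mu> = scale_measure (ennreal (real_of_prob \<rho>)) (restrict_proper \<mu>)"
| "restrict_event (Not E) \<mu> = restrict_proper \<mu> -\<^sub>m restrict_event E \<mu>"
| "restrict_event (And E1 E2) \<mu> = restrict_event E2 (restrict_event E1 \<mu>)"

definition assign :: "(('n \<Rightarrow> nat) \<Rightarrow> ('n \<Rightarrow> nat)) \<Rightarrow> 'n state measure \<Rightarrow> 'n state measure" where
  "assign f \<mu> = discrete_measure
     (\<lambda>S. emeasure (restrict_failure \<mu>) S + emeasure \<mu> {Some x | x. Some (f x) \<in> S})"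

definition fail_sem :: "'n state measure \<Rightarrow> 'n state measure" where
  "fail_sem \<mu> = scale_measure (emeasure \<mu> UNIV) (return (count_space UNIV) None)"

text \<open>
  Measure transformers are extensional functions on \<open>Meas\<close>, which makes the least fixed point
  unique as a HOL function. It exists by lemma \<open>least_fixpoint_while\<close>.
\<close>

definition while_op :: "'n event \<Rightarrow> ('n state measure \<Rightarrow> 'n state measure) \<Rightarrow>
    ('n state measure \<Rightarrow> 'n state measure) \<Rightarrow> ('n state measure \<Rightarrow> 'n state measure)" where
  "while_op E T \<psi> = (\<lambda>\<mu>\<in>Meas.
     restrict_failure \<mu> +\<^sub>m restrict_event (Not E) \<mu> +\<^sub>m \<psi> (T (restrict_event E \<mu>)))"

definition is_least_fixpoint :: "(('a measure \<Rightarrow> 'a measure) \<Rightarrow> ('a measure \<Rightarrow> 'a measure)) \<Rightarrow>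
    ('a measure \<Rightarrow> 'a measure) \<Rightarrow> bool" where
  "is_least_fixpoint \<Phi> \<psi> \<longleftrightarrow> \<psi> \<in> Meas \<rightarrow>\<^sub>E Meas \<and> \<Phi> \<psi> = \<psi> \<and>
     (\<forall>\<theta> \<in> Meas \<rightarrow>\<^sub>E Meas. \<Phi> \<theta> = \<theta> \<longrightarrow> \<psi> \<sqsubseteq> \<theta>)"

primrec sem :: "'n prog \<Rightarrow> 'n state measure \<Rightarrow> 'n state measure" where
  "sem Skip = (\<lambda>\<mu>. \<mu>)"
| "sem (Seq P1 P2) = (\<lambda>\<mu>. sem P2 (sem P1 \<mu>))"
| "sem (SetZero k) = assign (\<lambda>x. x(k := 0))"
| "sem (Incr k a) = assign (\<lambda>x. x(k := x k + a))"
| "sem (Decr k) = assign (\<lambda>x. x(k := x k - 1))"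
| "sem (Cond E P1 P2) = (\<lambda>\<mu>. restrict_failure \<mu> +\<^sub>m sem P1 (restrict_event E \<mu>)
     +\<^sub>m sem P2 (restrict_event (Not E) \<mu>))"
| "sem (While E P) = (THE \<psi>. is_least_fixpoint (while_op E (sem P)) \<psi>)"
| "sem Fail = fail_sem"

primrec sem_lo :: "'n prog \<Rightarrow> 'n state measure \<Rightarrow> 'n state measure" where
  "sem_lo Skip = (\<lambda>\<mu>. \<mu>)"
| "sem_lo (Seq P1 P2) = (\<lambda>\<mu>. sem_lo P2 (sem_lo P1 \<mu>))"
| "sem_lo (SetZero k) = assign (\<lambda>x. x(k := 0))"
| "sem_lo (Incr k a) = assign (\<lambda>x. x(k := x k + a))"
| "sem_lo (Decr k) = assign (\<lambda>x. x(k := x k - 1))"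
| "sem_lo (Cond E P1 P2) = (\<lambda>\<mu>. restrict_failure \<mu> +\<^sub>m sem_lo P1 (restrict_event E \<mu>)
     +\<^sub>m sem_lo P2 (restrict_event (Not E) \<mu>))"
| "sem_lo (While E P) = (\<lambda>\<mu>. zero_meas)"
| "sem_lo Fail = fail_sem"

text \<open>For a finite measure \<open>\<mu>\<close> this is finite; for an infinite one it is \<open>\<infinity>\<close>.\<close>

definition sem_res :: "'n prog \<Rightarrow> 'n state measure \<Rightarrow> ennreal" where
  "sem_res P \<mu> = emeasure \<mu> UNIV - emeasure (sem_lo P \<mu>) UNIV"

text \<open>
  A subset \<open>S\<close> of the proper state space is \<open>Some ` S\<close> in the space with failure. If all mass of
  a probability measure \<open>\<nu>\<close> is on failure, the quotient is \<open>0 / 0 = 0\<close> in \<open>ennreal\<close>.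
\<close>

definition normalize_meas :: "'n state measure \<Rightarrow> ('n \<Rightarrow> nat) measure" where
  "normalize_meas \<nu> = discrete_measure
     (\<lambda>S. emeasure (\<nu> -\<^sub>m restrict_failure \<nu>) (Some ` S) / (1 - emeasure \<nu> {None}))"


section \<open>Well-definedness\<close>

lemma sets_discrete_measure [simp]: "sets (discrete_measure f) = UNIV"
  unfolding discrete_measure_def
  by (metis Pow_UNIV sets_measure_of sigma_sets_top subset_UNIV top_greatest UNIV_eq_I
      sigma_sets.Basic UNIV_I)

lemma space_Meas: "\<mu> \<in> Meas \<Longrightarrow> space \<mu> = UNIV"
  unfolding Meas_def using sets.sets_into_space[of UNIV \<mu>] by auto

lemma discrete_measure_Meas [simp]: "discrete_measure f \<in> Meas"
  by (simp add: Meas_def)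

lemma diff_meas_Meas [simp]: "\<mu> -\<^sub>m \<nu> \<in> Meas"
  by (simp add: Meas_def diff_meas_def)

lemma Meas_ops [simp]:
  "restrict_meas \<mu> A \<in> Meas" "\<mu> +\<^sub>m \<nu> \<in> Meas" "zero_meas \<in> Meas"
  by (simp_all add: restrict_meas_def add_meas_def) (simp add: Meas_def)

lemma restrict_event_Meas [simp]: "restrict_event E \<mu> \<in> Meas"
proof (induction E arbitrary: \<mu>)
  case (Flip \<rho>)
  have "restrict_proper \<mu> \<in> Meas" by simp
  then show ?case by (simp add: Meas_def)
qed auto

lemma emeasure_discrete_measure:
  assumes "f {} = 0"
    and "\<And>A :: nat \<Rightarrow> 'a set. disjoint_family A \<Longrightarrow> (\<Sum>i. f (A i)) = f (\<Union>i. A i)"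
  shows "emeasure (discrete_measure f) S = f S"
proof (rule emeasure_measure_of[OF discrete_measure_def])
  show "countably_additive (sets (discrete_measure f)) f"
    by (rule countably_additiveI) (auto intro: assms(2))
qed (auto simp: positive_def assms(1))

lemma suminf_emeasure_Meas:
  "\<mu> \<in> Meas \<Longrightarrow> disjoint_family A \<Longrightarrow> (\<Sum>i. emeasure \<mu> (A i)) = emeasure \<mu> (\<Union>i. A i)"
  by (rule suminf_emeasure) (auto simp: Meas_def)

lemma emeasure_restrict_meas:
  assumes "\<mu> \<in> Meas"
  shows "emeasure (restrict_meas \<mu> A) S = emeasure \<mu> (S \<inter> A)"
  unfolding restrict_meas_def
proof (rule emeasure_discrete_measure)
  fix B :: "nat \<Rightarrow> 'a set" assume "disjoint_family B"
  then have "disjoint_family (\<lambda>i. B i \<inter> A)" by (auto simp: disjoint_family_on_def)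
  from suminf_emeasure_Meas[OF assms this]
  show "(\<Sum>i. emeasure \<mu> (B i \<inter> A)) = emeasure \<mu> ((\<Union>i. B i) \<inter> A)" by (simp add: UN_simps)
qed simp

lemma emeasure_add_meas:
  assumes "\<mu> \<in> Meas" "\<nu> \<in> Meas"
  shows "emeasure (\<mu> +\<^sub>m \<nu>) S = emeasure \<mu> S + emeasure \<nu> S"
  unfolding add_meas_def
  by (rule emeasure_discrete_measure)
    (auto simp: suminf_add[symmetric] suminf_emeasure_Meas assms)

lemma emeasure_diff_meas:
  fixes \<mu> \<nu> :: "'a :: countable measure"
  assumes "\<mu> \<in> Meas" "\<nu> \<in> Meas" "\<nu> \<preceq> \<mu>" "emeasure \<nu> UNIV \<noteq> \<infinity>"
  shows "emeasure (\<mu> -\<^sub>m \<nu>) S = emeasure \<mu> S - emeasure \<nu> S"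
proof -
  have pt: "emeasure \<kappa> S = (\<integral>\<^sup>+x\<in>S. emeasure \<kappa> {x} \<partial>count_space UNIV)"
    if "\<kappa> \<in> Meas" for \<kappa> :: "'a measure"
    using that emeasure_countable_singleton[of S \<kappa>]
    by (simp add: Meas_def nn_integral_count_space_indicator)
  have fin: "emeasure \<nu> S \<noteq> \<infinity>"
    using assms(2,4) emeasure_mono[of S UNIV \<nu>] by (auto simp: Meas_def top_unique)
  have "emeasure (\<mu> -\<^sub>m \<nu>) S =
      (\<integral>\<^sup>+x. emeasure \<mu> {x} * indicator S x - emeasure \<nu> {x} * indicator S x \<partial>count_space UNIV)"
    unfolding diff_meas_def
    by (subst emeasure_density) (auto intro!: nn_integral_cong split: split_indicator)
  also have "\<dots> = emeasure \<mu> S - emeasure \<nu> S"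
    unfolding pt[OF assms(1)] pt[OF assms(2)]
    by (rule nn_integral_diff)
      (use assms(3) fin pt[OF assms(2)] in
        \<open>auto simp: measure_leq_def intro!: mult_right_mono\<close>)
  finally show ?thesis .
qed

lemma restrict_event_le:
  fixes \<mu> :: "'n::finite state measure"
  shows "\<mu> \<in> Meas \<Longrightarrow> restrict_event E \<mu> \<preceq> restrict_proper \<mu>"
proof (induction E arbitrary: \<mu>)
  case (VarEq k a)
  then show ?case
    by (auto simp: measure_leq_def emeasure_restrict_meas Meas_def intro!: emeasure_mono)
next
  case (Flip \<rho>)
  have "ennreal (real_of_prob \<rho>) \<le> 1" using real_of_prob[of \<rho>] by simp
  then have "ennreal (real_of_prob \<rho>) * m \<le> m" for m
    using mult_right_mono[of "ennreal (real_of_prob \<rho>)" 1 m] by simp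
  then show ?case by (simp add: measure_leq_def)
next
  case (Not E)
  let ?\<nu> = "restrict_proper \<mu>"
  have "emeasure (?\<nu> -\<^sub>m restrict_event E \<mu>) S \<le> emeasure ?\<nu> S" for S
  proof -
    have "emeasure (?\<nu> -\<^sub>m restrict_event E \<mu>) S \<le>
        (\<integral>\<^sup>+x\<in>S. emeasure ?\<nu> {x} \<partial>count_space UNIV)"
      unfolding diff_meas_def
      by (subst emeasure_density)
        (auto intro!: nn_integral_mono mult_right_mono diff_le_self_ennreal)
    also have "\<dots> = emeasure ?\<nu> S"
      using emeasure_countable_singleton[of S ?\<nu>] Meas_ops(1)[of \<mu> "range Some"]
      by (simp add: Meas_def nn_integral_count_space_indicator)
    finally show ?thesis .
  qed
  then show ?case by (simp add: measure_leq_def)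
next
  case (And E1 E2)
  let ?\<nu> = "restrict_event E1 \<mu>"
  have "emeasure (restrict_event E2 ?\<nu>) S \<le> emeasure (restrict_proper \<mu>) S" for S
  proof -
    have "emeasure (restrict_event E2 ?\<nu>) S \<le> emeasure (restrict_proper ?\<nu>) S"
      using And.IH(2)[of ?\<nu>] by (simp add: measure_leq_def)
    also have "\<dots> \<le> emeasure ?\<nu> S"
    proof -
      have "S \<in> sets ?\<nu>" using restrict_event_Meas[of E1 \<mu>] unfolding Meas_def by simp
      then show ?thesis by (simp add: emeasure_restrict_meas emeasure_mono)
    qed
    also have "\<dots> \<le> emeasure (restrict_proper \<mu>) S"
      using And.IH(1)[OF And.prems] by (simp add: measure_leq_def)
    finally show ?thesis .
  qed
  then show ?case by (simp add: measure_leq_def)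
qed

lemma emeasure_assign:
  fixes \<mu> :: "'n state measure"
  assumes "\<mu> \<in> Meas"
  shows "emeasure (assign f \<mu>) S =
    emeasure (restrict_failure \<mu>) S + emeasure \<mu> {Some x | x. Some (f x) \<in> S}"
  unfolding assign_def
proof (rule emeasure_discrete_measure)
  fix A :: "nat \<Rightarrow> 'n state set" assume A: "disjoint_family A"
  then have "disjoint_family (\<lambda>i. {Some x | x. Some (f x) \<in> A i})"
    by (fastforce simp: disjoint_family_on_def)
  from suminf_emeasure_Meas[OF assms this]
  have "(\<Sum>i. emeasure \<mu> {Some x | x. Some (f x) \<in> A i}) =
      emeasure \<mu> {Some x | x. Some (f x) \<in> (\<Union>i. A i)}"
    by (rule trans) (rule arg_cong[where f = "emeasure \<mu>"], blast)
  with A show "(\<Sum>i. emeasure (restrict_failure \<mu>) (A i) +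
        emeasure \<mu> {Some x | x. Some (f x) \<in> A i}) =
      emeasure (restrict_failure \<mu>) (\<Union>i. A i) +
        emeasure \<mu> {Some x | x. Some (f x) \<in> (\<Union>i. A i)}"
    by (simp add: suminf_add[symmetric] suminf_emeasure_Meas)
qed simp

lemma emeasure_normalize_meas:
  fixes \<nu> :: "'n state measure"
  shows "emeasure (normalize_meas \<nu>) S =
    emeasure (\<nu> -\<^sub>m restrict_failure \<nu>) (Some ` S) / (1 - emeasure \<nu> {None})"
  unfolding normalize_meas_def
proof (rule emeasure_discrete_measure)
  fix A :: "nat \<Rightarrow> ('n \<Rightarrow> nat) set" assume "disjoint_family A"
  then have "disjoint_family (\<lambda>i. Some ` A i)" by (auto simp: disjoint_family_on_def)
  from suminf_emeasure_Meas[OF diff_meas_Meas this]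
  show "(\<Sum>i. emeasure (\<nu> -\<^sub>m restrict_failure \<nu>) (Some ` A i) / (1 - emeasure \<nu> {None})) =
      emeasure (\<nu> -\<^sub>m restrict_failure \<nu>) (Some ` (\<Union>i. A i)) / (1 - emeasure \<nu> {None})"
    by (simp add: divide_ennreal_def image_UN)
qed simp

lemma is_least_fixpoint_unique:
  assumes "is_least_fixpoint \<Phi> \<psi>" "is_least_fixpoint \<Phi> \<theta>"
  shows "\<psi> = \<theta>"
proof (rule PiE_ext[of _ Meas "\<lambda>_. Meas"])
  fix \<mu> :: "'a measure" assume \<mu>: "\<mu> \<in> Meas"
  have "\<psi> \<sqsubseteq> \<theta>" "\<theta> \<sqsubseteq> \<psi>" using assms by (auto simp: is_least_fixpoint_def)
  moreover have "\<psi> \<mu> \<in> Meas" "\<theta> \<mu> \<in> Meas"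
    using assms \<mu> by (auto simp: is_least_fixpoint_def)
  ultimately show "\<psi> \<mu> = \<theta> \<mu>"
    using \<mu> by (intro measure_eqI)
      (auto simp: Meas_def transformer_leq_def measure_leq_def intro!: antisym)
qed (use assms in \<open>auto simp: is_least_fixpoint_def\<close>)

lemma assign_Meas [simp]: "assign f \<mu> \<in> Meas"
  by (simp add: assign_def)

lemma fail_sem_Meas [simp]: "fail_sem \<mu> \<in> Meas"
  by (simp add: fail_sem_def Meas_def)

lemma ex_least_fixpoint_while:
  fixes T :: "'n state measure \<Rightarrow> 'n state measure"
  assumes T: "\<And>\<mu>. \<mu> \<in> Meas \<Longrightarrow> T \<mu> \<in> Meas"
  shows "\<exists>\<psi>. is_least_fixpoint (while_op E T) \<psi>"
proof -
  define a where "a = (\<lambda>\<mu>. restrict_failure \<mu> +\<^sub>m restrict_event (Not E) \<mu>)"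
  define U where "U = (\<lambda>\<mu>. T (restrict_event E \<mu>))"
  define \<psi> where "\<psi> = (\<lambda>\<mu>\<in>Meas. discrete_measure (\<lambda>S. \<Sum>i. emeasure (a ((U ^^ i) \<mu>)) S))"
  have a: "a \<mu> \<in> Meas" and U: "U \<mu> \<in> Meas" for \<mu>
    by (auto simp: a_def U_def intro!: T)
  have op: "while_op E T \<theta> = (\<lambda>\<mu>\<in>Meas. a \<mu> +\<^sub>m \<theta> (U \<mu>))" for \<theta>
    by (simp add: while_op_def a_def U_def)
  have em: "emeasure (\<psi> \<mu>) S = (\<Sum>i. emeasure (a ((U ^^ i) \<mu>)) S)" if "\<mu> \<in> Meas" for \<mu> S
  proof -
    have "emeasure (discrete_measure (\<lambda>S. \<Sum>i. emeasure (a ((U ^^ i) \<mu>)) S)) S =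
        (\<Sum>i. emeasure (a ((U ^^ i) \<mu>)) S)"
    proof (rule emeasure_discrete_measure)
      fix A :: "nat \<Rightarrow> 'n state set" assume A: "disjoint_family A"
      have "(\<Sum>j. \<Sum>i. emeasure (a ((U ^^ i) \<mu>)) (A j)) =
          (\<Sum>i. \<Sum>j. emeasure (a ((U ^^ i) \<mu>)) (A j))"
        using nn_integral_suminf[of "\<lambda>i j. emeasure (a ((U ^^ i) \<mu>)) (A j)" "count_space UNIV"]
        by (simp add: nn_integral_count_space_nat)
      then show "(\<Sum>j. \<Sum>i. emeasure (a ((U ^^ i) \<mu>)) (A j)) =
          (\<Sum>i. emeasure (a ((U ^^ i) \<mu>)) (\<Union>j. A j))"
        by (simp add: suminf_emeasure_Meas[OF a A])
    qed simp
    then show ?thesis using that by (simp add: \<psi>_def)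
  qed
  have \<psi>: "\<psi> \<in> Meas \<rightarrow>\<^sub>E Meas" by (auto simp: \<psi>_def)
  have "while_op E T \<psi> = \<psi>"
  proof (rule PiE_ext[of _ Meas "\<lambda>_. Meas"])
    fix \<mu> :: "'n state measure" assume \<mu>: "\<mu> \<in> Meas"
    have "emeasure (a \<mu> +\<^sub>m \<psi> (U \<mu>)) S = emeasure (\<psi> \<mu>) S" for S
    proof -
      have "emeasure (a \<mu> +\<^sub>m \<psi> (U \<mu>)) S =
          emeasure (a \<mu>) S + (\<Sum>i. emeasure (a ((U ^^ Suc i) \<mu>)) S)"
      proof -
        have "\<psi> (U \<mu>) \<in> Meas" using \<psi> U by auto
        then show ?thesis
          by (simp add: emeasure_add_meas[OF a] em[OF U] funpow_Suc_right del: funpow.simps)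
      qed
      also have "\<dots> = emeasure (\<psi> \<mu>) S"
        using suminf_offset[of "\<lambda>i. emeasure (a ((U ^^ i) \<mu>)) S" 1] by (simp add: em \<mu>)
      finally show ?thesis .
    qed
    moreover have "\<psi> \<mu> \<in> Meas" "a \<mu> +\<^sub>m \<psi> (U \<mu>) \<in> Meas" using \<psi> \<mu> by auto
    ultimately show "while_op E T \<psi> \<mu> = \<psi> \<mu>"
      using \<mu> unfolding op by (intro measure_eqI) (auto simp: Meas_def)
  qed (use \<psi> in \<open>auto simp: op\<close>)
  moreover have "\<psi> \<sqsubseteq> \<theta>" if \<theta>: "\<theta> \<in> Meas \<rightarrow>\<^sub>E Meas" "while_op E T \<theta> = \<theta>" for \<theta>
  proof -
    have step: "emeasure (\<theta> \<mu>) S = emeasure (a \<mu>) S + emeasure (\<theta> (U \<mu>)) S"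
      if "\<mu> \<in> Meas" for \<mu> S
    proof -
      have "\<theta> \<mu> = a \<mu> +\<^sub>m \<theta> (U \<mu>)"
        using that \<theta>(2) unfolding op by (metis restrict_apply')
      moreover have "\<theta> (U \<mu>) \<in> Meas" using \<theta>(1) U by auto
      ultimately show ?thesis by (simp add: emeasure_add_meas a)
    qed
    have "(\<Sum>i<k. emeasure (a ((U ^^ i) \<mu>)) S) + emeasure (\<theta> ((U ^^ k) \<mu>)) S =
        emeasure (\<theta> \<mu>) S" if "\<mu> \<in> Meas" for \<mu> S k
    proof (induction k)
      case (Suc k)
      have "(U ^^ k) \<mu> \<in> Meas" using that U by (cases k) auto
      from step[OF this, of S] Suc show ?case by (simp add: add.assoc)
    qed simp
    then have "(\<Sum>i<k. emeasure (a ((U ^^ i) \<mu>)) S) \<le> emeasure (\<theta> \<mu>) S"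
      if "\<mu> \<in> Meas" for \<mu> S k
      using that by (metis le_iff_add)
    then show ?thesis
      by (auto simp: transformer_leq_def measure_leq_def em intro!: suminf_le_const)
  qed
  ultimately show ?thesis using \<psi> by (auto simp: is_least_fixpoint_def)
qed

lemma sem_Meas: "\<mu> \<in> Meas \<Longrightarrow> sem P \<mu> \<in> Meas"
proof (induction P arbitrary: \<mu>)
  case (While E P)
  from ex_least_fixpoint_while[of "sem P" E, OF While.IH]
  obtain \<psi> where "is_least_fixpoint (while_op E (sem P)) \<psi>" by blast
  moreover from this have "(THE \<psi>. is_least_fixpoint (while_op E (sem P)) \<psi>) = \<psi>"
    by (blast intro: is_least_fixpoint_unique)
  ultimately show ?case using While.prems by (auto simp: is_least_fixpoint_def)
qed auto

lemma least_fixpoint_while: "is_least_fixpoint (while_op E (sem P)) (sem (While E P))"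
  using ex_least_fixpoint_while[of "sem P" E, OF sem_Meas]
  by (metis sem.simps(7) theI is_least_fixpoint_unique)

end

theory Submission
  imports Defs
begin

text \<open>
  The lower bound \<open>sem_lo P \<mu> \<preceq> sem P \<mu>\<close> follows by induction on \<open>P\<close> once \<open>sem_lo P\<close> is
  monotone. For the upper bound, \<open>sem P\<close> does not increase the total mass, so the lower bound on
  the complement of \<open>S\<close> leaves \<open>sem P \<mu>\<close> at most the residual mass in addition to
  \<open>sem_lo P \<mu>\<close> on \<open>S\<close>; for infinite \<open>\<mu>\<close> the residual mass is \<open>\<infinity>\<close>. The posterior bounds
  come from bounding numerator and denominator separately.
\<close>

section \<open>Events and the order on measures\<close>

lemma emeasure_mono_Meas: "\<mu> \<in> Meas \<Longrightarrow> A \<subseteq> B \<Longrightarrow> emeasure \<mu> A \<le> emeasure \<mu> B"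
  by (rule emeasure_mono) (auto simp: Meas_def)

text \<open>On a countable type a measure in \<open>Meas\<close> is the sum of its point masses.
  This suits negated events, whose difference is defined on point masses.\<close>

lemma measure_leq_singletonI:
  fixes \<mu> \<nu> :: "'a :: countable measure"
  assumes "\<mu> \<in> Meas" "\<nu> \<in> Meas" and le: "\<And>x. emeasure \<mu> {x} \<le> emeasure \<nu> {x}"
  shows "\<mu> \<preceq> \<nu>"
proof -
  have pt: "emeasure \<kappa> S = (\<integral>\<^sup>+x\<in>S. emeasure \<kappa> {x} \<partial>count_space UNIV)"
    if "\<kappa> \<in> Meas" for \<kappa> :: "'a measure" and S
    using that emeasure_countable_singleton[of S \<kappa>]
    by (simp add: Meas_def nn_integral_count_space_indicator)
  have "emeasure \<mu> S \<le> emeasure \<nu> S" for S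
    by (subst (1 2) pt) (auto intro!: assms nn_integral_mono mult_right_mono)
  then show ?thesis by (simp add: measure_leq_def)
qed

lemma emeasure_diff_meas_singleton:
  "emeasure (\<mu> -\<^sub>m \<nu>) {x} = emeasure \<mu> {x} - emeasure \<nu> {x}"
  unfolding diff_meas_def
  by (subst emeasure_density) simp_all

text \<open>Finiteness matters: for \<open>c = 1\<close> and \<open>m = \<top>\<close> the left side
  is \<open>\<top>\<close> and the right side is \<open>0\<close>.\<close>

lemma mult_one_minus_ennreal:
  assumes "c \<le> 1" "m \<noteq> (\<top> :: ennreal)"
  shows "m - c * m = (1 - c) * m"
proof -
  obtain a b where "0 \<le> a" "c = ennreal a" "0 \<le> b" "m = ennreal b"
    using assms by (cases c; cases m) (auto simp: top_unique)
  moreover from this have "a \<le> 1" using assms(1) by simp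
  ultimately show ?thesis
    by (simp add: ennreal_mult[symmetric] ennreal_minus left_diff_distrib flip: ennreal_1)
qed

text \<open>
  The scaling factor \<open>c\<close> is lost at infinite mass: there \<open>\<infinity> - \<infinity> = \<infinity>\<close> in \<open>ennreal\<close>, so that a
  negated event keeps the whole mass. Linearity on finite masses is what makes
  \<open>m - g m\<close> monotone again.
\<close>

lemma restrict_event_singleton:
  fixes E :: "'n event"
  shows "\<exists>g. mono g \<and> (\<forall>\<mu>\<in>Meas. emeasure (restrict_event E \<mu>) {x} = g (emeasure \<mu> {x})) \<and>
    (\<exists>c\<le>1. \<forall>m. m \<noteq> \<top> \<longrightarrow> g m = c * m)"
proof (induction E)
  case (VarEq k a)
  define c :: ennreal where "c = of_bool (x \<in> {Some y | y. y k = a})"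
  have "emeasure (restrict_event (VarEq k a) \<mu>) {x} = c * emeasure \<mu> {x}" if "\<mu> \<in> Meas" for \<mu>
    using that by (auto simp: emeasure_restrict_meas c_def)
  moreover have "c \<le> 1" by (simp add: c_def)
  ultimately show ?case
    by (intro exI[of _ "\<lambda>m. c * m"]) (auto intro!: monoI mult_left_mono)
next
  case (Flip \<rho>)
  define c where "c = (if x = None then 0 else ennreal (real_of_prob \<rho>))"
  have "emeasure (restrict_event (Flip \<rho>) \<mu>) {x} = c * emeasure \<mu> {x}" if "\<mu> \<in> Meas" for \<mu>
    using that by (cases x) (auto simp: emeasure_restrict_meas c_def)
  moreover have "c \<le> 1" using real_of_prob[of \<rho>] by (simp add: c_def)
  ultimately show ?case
    by (intro exI[of _ "\<lambda>m. c * m"]) (auto intro!: monoI mult_left_mono)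
next
  case (Not E)
  then obtain g c where g: "mono g" "c \<le> 1" "\<And>m. m \<noteq> \<top> \<Longrightarrow> g m = c * m"
      "\<And>\<mu>. \<mu> \<in> Meas \<Longrightarrow> emeasure (restrict_event E \<mu>) {x} = g (emeasure \<mu> {x})"
    by blast
  show ?case
  proof (cases x)
    case None
    \<comment> \<open>Negation subtracts from the proper part, which has no mass at failure.\<close>
    have "emeasure (restrict_event (Not E) \<mu>) {x} = 0" if "\<mu> \<in> Meas" for \<mu>
      using that None by (simp add: emeasure_diff_meas_singleton emeasure_restrict_meas)
    then show ?thesis by (intro exI[of _ "\<lambda>_. 0"]) (auto intro!: monoI exI[of _ 0])
  next
    case (Some y)
    let ?h = "\<lambda>m. m - g m"
    have lin: "?h m = (1 - c) * m" if "m \<noteq> \<top>" for m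
      using that g(2,3) by (simp add: mult_one_minus_ennreal)
    have "?h m \<le> ?h n" if "m \<le> n" for m n
    \<comment> \<open>If \<open>n = \<top>\<close> then \<open>?h n = \<top>\<close>, whatever
      \<open>g\<close> is; otherwise \<open>m\<close> and \<open>n\<close> are both finite and
      \<open>?h\<close> multiplies them by \<open>1 - c\<close>.\<close>
    proof (cases "n = \<top>")
      case False
      with that have "m \<noteq> \<top>" by (auto simp: top_unique)
      with False that show ?thesis by (simp add: lin mult_left_mono)
    qed simp
    then have "mono ?h" by (rule monoI)
    moreover have "emeasure (restrict_event (Not E) \<mu>) {x} = ?h (emeasure \<mu> {x})"
      if "\<mu> \<in> Meas" for \<mu>
      using that Some g(4)
      by (simp add: emeasure_diff_meas_singleton emeasure_restrict_meas)
    moreover have "1 - c \<le> 1" by (rule diff_le_self_ennreal)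
    ultimately show ?thesis using lin by blast
  qed
next
  case (And E1 E2)
  then obtain g c h d where g: "mono g" "c \<le> 1" "\<And>m. m \<noteq> \<top> \<Longrightarrow> g m = c * m"
      "\<And>\<mu>. \<mu> \<in> Meas \<Longrightarrow> emeasure (restrict_event E1 \<mu>) {x} = g (emeasure \<mu> {x})"
    and h: "mono h" "d \<le> 1" "\<And>m. m \<noteq> \<top> \<Longrightarrow> h m = d * m"
      "\<And>\<mu>. \<mu> \<in> Meas \<Longrightarrow> emeasure (restrict_event E2 \<mu>) {x} = h (emeasure \<mu> {x})"
    by metis
  have "mono (\<lambda>m. h (g m))" using g(1) h(1) by (auto simp: mono_def)
  moreover have "h (g m) = (d * c) * m" if "m \<noteq> \<top>" for m
  proof -
    \<comment> \<open>The linear form of \<open>h\<close> is available at finite masses only, so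
      \<open>g m\<close> must be finite.\<close>
    have "c * m \<noteq> \<top>" using that g(2) by (auto simp: ennreal_mult_eq_top_iff top_unique)
    then show ?thesis using that by (simp add: g(3) h(3) mult.assoc)
  qed
  moreover have "d * c \<le> 1" using mult_mono[OF h(2) g(2)] by simp
  ultimately show ?case using g(4) h(4) by (intro exI[of _ "\<lambda>m. h (g m)"]) auto
qed

text \<open>Not immediate for negations, where the subtracted measure grows too. At each point an
  event acts through one monotone function of the mass there.\<close>

lemma restrict_event_mono:
  fixes \<mu> \<nu> :: "'n::finite state measure"
  assumes "\<mu> \<in> Meas" "\<nu> \<in> Meas" "\<mu> \<preceq> \<nu>"
  shows "restrict_event E \<mu> \<preceq> restrict_event E \<nu>"
proof (rule measure_leq_singletonI)
  fix x
  obtain g where "mono g"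
    "\<forall>\<mu>\<in>Meas. emeasure (restrict_event E \<mu>) {x} = g (emeasure \<mu> {x})"
    using restrict_event_singleton by blast
  with assms show "emeasure (restrict_event E \<mu>) {x} \<le> emeasure (restrict_event E \<nu>) {x}"
    by (auto simp: measure_leq_def dest: monoD)
qed simp_all

section \<open>The lower bound\<close>

lemma sem_lo_Meas: "\<mu> \<in> Meas \<Longrightarrow> sem_lo P \<mu> \<in> Meas"
  by (induction P arbitrary: \<mu>) auto

text \<open>Serves the lower bound for sequences, where the second program starts from two different
  measures. Loops are immediate: their lower semantics is constant.\<close>

lemma sem_lo_mono:
  fixes \<mu> \<nu> :: "'n::finite state measure"
  assumes "\<mu> \<in> Meas" "\<nu> \<in> Meas" "\<mu> \<preceq> \<nu>"
  shows "sem_lo P \<mu> \<preceq> sem_lo P \<nu>"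
  using assms
proof (induction P arbitrary: \<mu> \<nu>)
  case (Seq P1 P2)
  then show ?case by (simp add: sem_lo_Meas)
next
  case (Cond E P1 P2)
  then have "sem_lo P1 (restrict_event E \<mu>) \<preceq> sem_lo P1 (restrict_event E \<nu>)"
    "sem_lo P2 (restrict_event (Not E) \<mu>) \<preceq> sem_lo P2 (restrict_event (Not E) \<nu>)"
    by (auto simp del: restrict_event.simps intro!: Cond.IH restrict_event_mono)
  with Cond.prems show ?case
    by (simp add: measure_leq_def emeasure_add_meas sem_lo_Meas emeasure_restrict_meas
        add_mono del: restrict_event.simps)
qed (auto simp: measure_leq_def emeasure_assign emeasure_restrict_meas fail_sem_def
    intro!: add_mono mult_right_mono)

lemma sem_lo_le_sem:
  fixes \<mu> :: "'n::finite state measure"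
  assumes "\<mu> \<in> Meas"
  shows "sem_lo P \<mu> \<preceq> sem P \<mu>"
  using assms
proof (induction P arbitrary: \<mu>)
  case (Seq P1 P2)
  \<comment> \<open>With \<open>sem_lo P2 (sem P1 \<mu>)\<close> in the middle, only the lower
    semantics has to be monotone.\<close>
  have "sem_lo P2 (sem_lo P1 \<mu>) \<preceq> sem_lo P2 (sem P1 \<mu>)"
    using Seq by (intro sem_lo_mono) (auto simp: sem_lo_Meas sem_Meas)
  moreover have "sem_lo P2 (sem P1 \<mu>) \<preceq> sem P2 (sem P1 \<mu>)"
    using Seq by (simp add: sem_Meas)
  ultimately show ?case by (auto simp: measure_leq_def intro: order_trans)
next
  case (Cond E P1 P2)
  then have "sem_lo P1 (restrict_event E \<mu>) \<preceq> sem P1 (restrict_event E \<mu>)"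
    "sem_lo P2 (restrict_event (Not E) \<mu>) \<preceq> sem P2 (restrict_event (Not E) \<mu>)"
    by (auto simp del: restrict_event.simps)
  then show ?case
    by (simp add: measure_leq_def emeasure_add_meas sem_lo_Meas sem_Meas add_mono
        del: restrict_event.simps)
qed (auto simp: measure_leq_def)

section \<open>Total mass does not grow\<close>

lemma emeasure_failure_plus_proper:
  assumes "\<mu> \<in> Meas"
  shows "emeasure \<mu> {None} + emeasure \<mu> (range Some) = emeasure \<mu> UNIV"
proof -
  have "emeasure \<mu> {None} + emeasure \<mu> (range Some) = emeasure \<mu> ({None} \<union> range Some)"
    using assms by (intro plus_emeasure) (auto simp: Meas_def)
  also have "{None} \<union> range Some = UNIV" by (simp add: UNIV_option_conv)
  finally show ?thesis .
qed

lemma emeasure_assign_UNIV: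
  assumes "\<mu> \<in> Meas"
  shows "emeasure (assign f \<mu>) UNIV = emeasure \<mu> UNIV"
proof -
  have "{Some x | x. Some (f x) \<in> UNIV} = range Some" by auto
  with assms show ?thesis
    using emeasure_failure_plus_proper[OF assms]
    by (simp only: emeasure_assign emeasure_restrict_meas Int_UNIV_left)
qed

text \<open>At finite mass an event and its negation add up to the proper part. At infinite mass the
  negation may count mass twice, but the bound is trivial.\<close>

lemma mass_split_event:
  fixes \<mu> :: "'n::finite state measure"
  assumes \<mu>: "\<mu> \<in> Meas"
  shows "emeasure (restrict_failure \<mu>) UNIV + emeasure (restrict_event (Not E) \<mu>) UNIV +
    emeasure (restrict_event E \<mu>) UNIV \<le> emeasure \<mu> UNIV"
proof (cases "emeasure \<mu> UNIV = \<infinity>")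
  case False
  have le: "restrict_event E \<mu> \<preceq> restrict_proper \<mu>" using restrict_event_le[OF \<mu>] .
  then have le': "emeasure (restrict_event E \<mu>) UNIV \<le> emeasure \<mu> (range Some)"
    using \<mu> by (metis measure_leq_def emeasure_restrict_meas Int_UNIV_left)
  also have "\<dots> \<le> emeasure \<mu> UNIV" using \<mu> by (simp add: emeasure_mono_Meas)
  finally have "emeasure (restrict_event E \<mu>) UNIV \<noteq> \<infinity>"
    using False by (auto simp: top_unique)
  then have "emeasure (restrict_event (Not E) \<mu>) UNIV + emeasure (restrict_event E \<mu>) UNIV =
      emeasure \<mu> (range Some)"
    using \<mu> le le' by (simp add: emeasure_diff_meas emeasure_restrict_meas diff_add_cancel_ennreal)
  moreover have "emeasure \<mu> {None} + emeasure \<mu> (range Some) = emeasure \<mu> UNIV"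
    by (rule emeasure_failure_plus_proper[OF \<mu>])
  ultimately show ?thesis
    using \<mu> by (simp add: emeasure_restrict_meas add.assoc del: restrict_event.simps)
qed simp

text \<open>
  Least fixed points are only known to lie below other fixed points. The series of unrollings is
  one, and its partial sums are controlled by the mass that has not yet left the loop.
\<close>

lemma least_fixpoint_while_mass:
  fixes T :: "'n::finite state measure \<Rightarrow> 'n state measure"
  assumes T: "\<And>\<mu>. \<mu> \<in> Meas \<Longrightarrow> T \<mu> \<in> Meas"
    and mass: "\<And>\<mu>. \<mu> \<in> Meas \<Longrightarrow> emeasure (T \<mu>) UNIV \<le> emeasure \<mu> UNIV"
    and lfp: "is_least_fixpoint (while_op E T) \<psi>"
    and \<mu>: "\<mu> \<in> Meas"
  shows "emeasure (\<psi> \<mu>) UNIV \<le> emeasure \<mu> UNIV"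
proof -
  define a where "a = (\<lambda>\<mu>. restrict_failure \<mu> +\<^sub>m restrict_event (Not E) \<mu>)"
  define U where "U = (\<lambda>\<mu>. T (restrict_event E \<mu>))"
  \<comment> \<open>\<open>(U ^^ i) \<mu>\<close> is the measure after \<open>i\<close> passes
    through the loop, and \<open>a\<close> takes the part of it that leaves there.\<close>
  define \<theta> where "\<theta> = (\<lambda>\<mu>\<in>Meas. discrete_measure (\<lambda>S. \<Sum>i. emeasure (a ((U ^^ i) \<mu>)) S))"
  have a: "a \<nu> \<in> Meas" and U: "U \<nu> \<in> Meas" for \<nu>
    by (auto simp: a_def U_def intro!: T)
  have em: "emeasure (\<theta> \<nu>) S = (\<Sum>i. emeasure (a ((U ^^ i) \<nu>)) S)" if "\<nu> \<in> Meas" for \<nu> S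
  proof -
    have "emeasure (discrete_measure (\<lambda>S. \<Sum>i. emeasure (a ((U ^^ i) \<nu>)) S)) S =
        (\<Sum>i. emeasure (a ((U ^^ i) \<nu>)) S)"
    proof (rule emeasure_discrete_measure)
      fix A :: "nat \<Rightarrow> 'n state set" assume A: "disjoint_family A"
      \<comment> \<open>One of the two sums is read as an integral over the counting measure on
        \<open>nat\<close>, which commutes with series.\<close>
      have "(\<Sum>j. \<Sum>i. emeasure (a ((U ^^ i) \<nu>)) (A j)) =
          (\<Sum>i. \<Sum>j. emeasure (a ((U ^^ i) \<nu>)) (A j))"
        using nn_integral_suminf[of "\<lambda>i j. emeasure (a ((U ^^ i) \<nu>)) (A j)" "count_space UNIV"]
        by (simp add: nn_integral_count_space_nat)
      then show "(\<Sum>j. \<Sum>i. emeasure (a ((U ^^ i) \<nu>)) (A j)) =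
          (\<Sum>i. emeasure (a ((U ^^ i) \<nu>)) (\<Union>j. A j))"
        by (simp add: suminf_emeasure_Meas[OF a A])
    qed simp
    then show ?thesis using that by (simp add: \<theta>_def)
  qed
  have \<theta>: "\<theta> \<in> Meas \<rightarrow>\<^sub>E Meas" by (auto simp: \<theta>_def)
  have "while_op E T \<theta> \<nu> = \<theta> \<nu>" for \<nu>
  proof (cases "\<nu> \<in> Meas")
    case True
    have "\<theta> \<nu> \<in> Meas" "\<theta> (U \<nu>) \<in> Meas" using \<theta> U True by auto
    moreover have "emeasure (\<theta> \<nu>) S = emeasure (a \<nu>) S + emeasure (\<theta> (U \<nu>)) S" for S
      using suminf_offset[of "\<lambda>i. emeasure (a ((U ^^ i) \<nu>)) S" 1]
      by (simp add: em True U funpow_swap1)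
    ultimately have "a \<nu> +\<^sub>m \<theta> (U \<nu>) = \<theta> \<nu>"
      using Meas_ops(2)[of "a \<nu>" "\<theta> (U \<nu>)"]
      by (intro measure_eqI) (simp add: Meas_def, simp add: emeasure_add_meas a)
    with True show ?thesis by (simp add: while_op_def a_def U_def)
  qed (simp add: while_op_def \<theta>_def)
  then have "while_op E T \<theta> = \<theta>" by blast
  then have "\<psi> \<sqsubseteq> \<theta>" using lfp \<theta> by (auto simp: is_least_fixpoint_def)
  then have "emeasure (\<psi> \<mu>) UNIV \<le> emeasure (\<theta> \<mu>) UNIV"
    using \<mu> by (auto simp: transformer_leq_def measure_leq_def)
  also have "\<dots> \<le> emeasure \<mu> UNIV"
  proof -
    have step: "emeasure (a \<nu>) UNIV + emeasure (U \<nu>) UNIV \<le> emeasure \<nu> UNIV"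
      if "\<nu> \<in> Meas" for \<nu>
    proof -
      have "emeasure (a \<nu>) UNIV + emeasure (U \<nu>) UNIV \<le>
          emeasure (a \<nu>) UNIV + emeasure (restrict_event E \<nu>) UNIV"
        by (intro add_left_mono) (simp add: U_def mass)
      also have "\<dots> \<le> emeasure \<nu> UNIV"
        using mass_split_event[OF that, of E]
        by (simp add: a_def emeasure_add_meas del: restrict_event.simps)
      finally show ?thesis .
    qed
    \<comment> \<open>The second summand, the mass still inside the loop, carries the induction and
      is dropped afterwards.\<close>
    have "(\<Sum>i<k. emeasure (a ((U ^^ i) \<mu>)) UNIV) + emeasure ((U ^^ k) \<mu>) UNIV
        \<le> emeasure \<mu> UNIV" for k
    proof (induction k)
      case (Suc k)
      have "(U ^^ k) \<mu> \<in> Meas" using \<mu> U by (cases k) auto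
      from add_left_mono[OF step[OF this]]
      have "(\<Sum>i<k. emeasure (a ((U ^^ i) \<mu>)) UNIV) +
          (emeasure (a ((U ^^ k) \<mu>)) UNIV + emeasure (U ((U ^^ k) \<mu>)) UNIV) \<le>
          (\<Sum>i<k. emeasure (a ((U ^^ i) \<mu>)) UNIV) + emeasure ((U ^^ k) \<mu>) UNIV" .
      also note Suc
      finally show ?case by (simp add: add.assoc)
    qed simp
    then have "(\<Sum>i<k. emeasure (a ((U ^^ i) \<mu>)) UNIV) \<le> emeasure \<mu> UNIV" for k
      by (rule order_trans[OF add_increasing2[OF zero_le order_refl]])
    then show ?thesis by (auto simp: em \<mu> intro!: suminf_le_const)
  qed
  finally show ?thesis .
qed

text \<open>Equality can fail: loops lose the mass of nonterminating runs.\<close>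

lemma sem_mass_le:
  fixes \<mu> :: "'n::finite state measure"
  assumes "\<mu> \<in> Meas"
  shows "emeasure (sem P \<mu>) UNIV \<le> emeasure \<mu> UNIV"
  using assms
proof (induction P arbitrary: \<mu>)
  case (Seq P1 P2)
  from order_trans[OF Seq.IH(2)[OF sem_Meas[OF Seq.prems]] Seq.IH(1)[OF Seq.prems]]
  show ?case by simp
next
  case (Cond E P1 P2)
  have "emeasure (sem (Cond E P1 P2) \<mu>) UNIV \<le> emeasure (restrict_failure \<mu>) UNIV +
      emeasure (restrict_event E \<mu>) UNIV + emeasure (restrict_event (Not E) \<mu>) UNIV"
    using Cond.IH by (simp add: emeasure_add_meas sem_Meas add_mono del: restrict_event.simps)
  also have "\<dots> \<le> emeasure \<mu> UNIV"
    using mass_split_event[OF Cond.prems, of E] by (simp add: ac_simps del: restrict_event.simps)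
  finally show ?case .
next
  case (While E P)
  from least_fixpoint_while_mass[OF sem_Meas While.IH least_fixpoint_while While.prems]
  show ?case .
next
  case Fail
  then show ?case by (simp add: fail_sem_def)
qed (simp_all add: emeasure_assign_UNIV)

section \<open>The upper bound by the residual mass\<close>

lemma sem_le_sem_lo_plus_res:
  fixes \<mu> :: "'n::finite state measure"
  assumes \<mu>: "\<mu> \<in> Meas"
  shows "emeasure (sem P \<mu>) S \<le> emeasure (sem_lo P \<mu>) S + sem_res P \<mu>"
proof (cases "emeasure \<mu> UNIV = \<infinity>")
  case True
  then show ?thesis by (simp add: sem_res_def)
next
  case False
  let ?n = "sem P \<mu>" and ?l = "sem_lo P \<mu>"
  have split: "emeasure \<kappa> S + emeasure \<kappa> (- S) = emeasure \<kappa> UNIV"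
    if "\<kappa> \<in> Meas" for \<kappa> :: "'n state measure"
    using that plus_emeasure[of S \<kappa> "- S"] by (simp add: Meas_def)
  have le: "emeasure ?l A \<le> emeasure ?n A" for A
    using sem_lo_le_sem[OF \<mu>] by (simp add: measure_leq_def)
  have mass: "emeasure ?n UNIV \<le> emeasure \<mu> UNIV" by (rule sem_mass_le[OF \<mu>])
  with le[of UNIV] have lo_mass: "emeasure ?l UNIV \<le> emeasure \<mu> UNIV" by (rule order_trans)
  \<comment> \<open>Finiteness allows the lower mass of \<open>- S\<close> to be cancelled at the
    end.\<close>
  with False have "emeasure ?l UNIV \<noteq> \<top>" by (auto simp: top_unique)
  then have fin: "emeasure ?l (- S) \<noteq> \<top>"
    using split[OF sem_lo_Meas[OF \<mu>, of P]] by (metis ennreal_add_eq_top)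
  have "emeasure ?n S + emeasure ?l (- S) \<le> emeasure ?n UNIV"
    using le[of "- S"] by (simp add: split[OF sem_Meas[OF \<mu>], symmetric] add_left_mono)
  also have "\<dots> \<le> emeasure \<mu> UNIV" by (rule mass)
  also have "emeasure \<mu> UNIV = emeasure ?l UNIV + sem_res P \<mu>"
    using lo_mass by (simp add: sem_res_def add_diff_inverse_ennreal)
  also have "\<dots> = (emeasure ?l S + sem_res P \<mu>) + emeasure ?l (- S)"
    by (simp add: split[OF sem_lo_Meas[OF \<mu>], symmetric] ac_simps)
  finally show ?thesis
    using fin by (simp add: ennreal_add_left_cancel_le add.commute[of _ "emeasure ?l (- S)"])
qed

section \<open>Normalization and the posterior bounds\<close>

lemma emeasure_normalize_meas_finite:
  fixes \<nu> :: "'n::finite state measure"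
  assumes \<nu>: "\<nu> \<in> Meas" and fin: "emeasure \<nu> {None} \<noteq> \<infinity>"
  shows "emeasure (normalize_meas \<nu>) S = emeasure \<nu> (Some ` S) / (1 - emeasure \<nu> {None})"
proof -
  have "restrict_failure \<nu> \<preceq> \<nu>"
    using \<nu> by (simp add: measure_leq_def emeasure_restrict_meas emeasure_mono_Meas)
  moreover have "Some ` S \<inter> {None} = {}" by auto
  ultimately show ?thesis
    using \<nu> fin by (simp add: emeasure_normalize_meas emeasure_diff_meas emeasure_restrict_meas)
qed

text \<open>Inversion is antitone on all of \<open>ennreal\<close>, with
  \<open>inverse 0 = \<top>\<close>, so zero denominators are covered.\<close>

lemma divide_mono_ennreal:
  fixes a b c d :: ennreal
  assumes "a \<le> b" "d \<le> c"
  shows "a / c \<le> b / d"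
proof -
  have "inverse c \<le> inverse d"
    including ennreal.lifting
    using assms(2) by transfer (rule ereal_inverse_antimono)
  with assms(1) show ?thesis by (simp add: divide_ennreal_def mult_mono)
qed

theorem theorem3p4:
  fixes P :: "'n::finite prog" and \<mu> :: "'n state measure"
  assumes "\<mu> \<in> Meas"
  shows "(\<forall>S :: 'n state set.
            emeasure (sem_lo P \<mu>) S \<le> emeasure (sem P \<mu>) S \<and>
            emeasure (sem P \<mu>) S \<le> emeasure (sem_lo P \<mu>) S + sem_res P \<mu>) \<and>
         (prob_space \<mu> \<longrightarrow> (\<forall>S :: ('n \<Rightarrow> nat) set.
            emeasure (sem_lo P \<mu>) (Some ` S) / (1 - emeasure (sem_lo P \<mu>) {None})
              \<le> emeasure (normalize_meas (sem P \<mu>)) S \<and>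
            emeasure (normalize_meas (sem P \<mu>)) S
              \<le> (emeasure (sem_lo P \<mu>) (Some ` S) + sem_res P \<mu>) /
                 (1 - emeasure (sem_lo P \<mu>) {None} - sem_res P \<mu>)))"
proof (intro conjI allI impI)
  fix S :: "'n state set"
  show "emeasure (sem_lo P \<mu>) S \<le> emeasure (sem P \<mu>) S"
    using sem_lo_le_sem[OF assms] by (simp add: measure_leq_def)
  show "emeasure (sem P \<mu>) S \<le> emeasure (sem_lo P \<mu>) S + sem_res P \<mu>"
    by (rule sem_le_sem_lo_plus_res[OF assms])
next
  fix S :: "('n \<Rightarrow> nat) set"
  assume "prob_space \<mu>"
  then have "emeasure \<mu> UNIV = 1"
    using prob_space.emeasure_space_1[of \<mu>] space_Meas[OF assms] by simp
  then have "emeasure (sem P \<mu>) {None} \<le> 1"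
    using sem_mass_le[OF assms, of P] emeasure_mono_Meas[OF sem_Meas[OF assms], of "{None}" UNIV P]
    by simp
  then have norm: "emeasure (normalize_meas (sem P \<mu>)) S =
      emeasure (sem P \<mu>) (Some ` S) / (1 - emeasure (sem P \<mu>) {None})"
    by (intro emeasure_normalize_meas_finite sem_Meas assms) (auto simp: top_unique)
  have lower: "emeasure (sem_lo P \<mu>) A \<le> emeasure (sem P \<mu>) A"
    and upper: "emeasure (sem P \<mu>) A \<le> emeasure (sem_lo P \<mu>) A + sem_res P \<mu>" for A
    using sem_lo_le_sem[OF assms] sem_le_sem_lo_plus_res[OF assms]
    by (auto simp: measure_leq_def)
  show "emeasure (sem_lo P \<mu>) (Some ` S) / (1 - emeasure (sem_lo P \<mu>) {None})
      \<le> emeasure (normalize_meas (sem P \<mu>)) S"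
    unfolding norm by (intro divide_mono_ennreal lower ennreal_mono_minus order_refl)
  show "emeasure (normalize_meas (sem P \<mu>)) S
      \<le> (emeasure (sem_lo P \<mu>) (Some ` S) + sem_res P \<mu>) /
         (1 - emeasure (sem_lo P \<mu>) {None} - sem_res P \<mu>)"
    \<comment> \<open>The right denominator becomes \<open>1\<close> minus a sum, and the upper
      bound at \<open>{None}\<close> compares the denominators.\<close>
    unfolding norm diff_add_eq_diff_diff_swap_ennreal[symmetric]
    by (intro divide_mono_ennreal ennreal_mono_minus upper)
qed

end
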